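(* For every $n\ge1$, the semigroup $\mathcal{ODCT}_n$ is left abundant, i.e. every $\mathcal{L}^*$-class of $\mathcal{ODCT}_n$ contains an idempotent.
   Context: $[n]=\{1,2,\ldots,n\}$ with its usual order. Maps are written on the right of their arguments. $\mathcal{ODCT}_n$ is the semigroup (under composition, $x(\alpha\beta)=(x\alpha)\beta$) of all maps $\alpha:[n]\to[n]$ that are contractions ($|x\alpha-y\alpha|\le|x-y|$ for all $x,y\in[n]$), order-preserving ($x\le y\Rightarrow x\alpha\le y\alpha$) and order-decreasing ($x\alpha\le x$ for all $x\in[n]$). On a semigroup $S$, $\mathcal{L}^*=\{(\alpha,\beta)\in S\times S: \text{for all }\mu,\lambda\in S^1,\ \alpha\mu=\alpha\lambda \iff \beta\mu=\beta\lambda\}$. A semigroup is called left abundant here if each of its $\mathcal{L}^*$-classes contains an idempotent. *)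

theory Defs
  imports Main "HOL-Library.FuncSet"
begin

text \<open>A semigroup is given by a carrier set together with a binary operation.\<close>

definition semigroup_on :: "'a set \<Rightarrow> ('a \<Rightarrow> 'a \<Rightarrow> 'a) \<Rightarrow> bool" where
  "semigroup_on S m \<longleftrightarrow>
     (\<forall>a\<in>S. \<forall>b\<in>S. m a b \<in> S) \<and>
     (\<forall>a\<in>S. \<forall>b\<in>S. \<forall>c\<in>S. m (m a b) c = m a (m b c))"

definition has_identity :: "'a set \<Rightarrow> ('a \<Rightarrow> 'a \<Rightarrow> 'a) \<Rightarrow> bool" where
  "has_identity S m \<longleftrightarrow> (\<exists>e\<in>S. \<forall>a\<in>S. m e a = a \<and> m a e = a)"

text \<open>The monoid \<open>S\<^sup>1\<close>: elements of \<open>S\<close> are embedded by \<^const>\<open>Some\<close>, and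
  \<^const>\<open>None\<close> is the identity that is adjoined only if \<open>S\<close> does not have one.\<close>

definition S1 :: "'a set \<Rightarrow> ('a \<Rightarrow> 'a \<Rightarrow> 'a) \<Rightarrow> 'a option set" where
  "S1 S m = (if has_identity S m then Some ` S else insert None (Some ` S))"

text \<open>The product of an element of \<open>S\<close> with an element of \<open>S\<^sup>1\<close> on its right.\<close>

definition mult1 :: "('a \<Rightarrow> 'a \<Rightarrow> 'a) \<Rightarrow> 'a \<Rightarrow> 'a option \<Rightarrow> 'a" where
  "mult1 m a u = (case u of None \<Rightarrow> a | Some b \<Rightarrow> m a b)"

definition Lstar :: "'a set \<Rightarrow> ('a \<Rightarrow> 'a \<Rightarrow> 'a) \<Rightarrow> ('a \<times> 'a) set" where
  "Lstar S m = {(a, b) \<in> S \<times> S. \<forall>u\<in>S1 S m. \<forall>v\<in>S1 S m.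
     mult1 m a u = mult1 m a v \<longleftrightarrow> mult1 m b u = mult1 m b v}"

lemma equiv_Lstar: "equiv S (Lstar S m)"
  by (rule equivI) (auto simp: Lstar_def refl_on_def sym_def trans_def)

definition left_abundant :: "'a set \<Rightarrow> ('a \<Rightarrow> 'a \<Rightarrow> 'a) \<Rightarrow> bool" where
  "left_abundant S m \<longleftrightarrow> (\<forall>C \<in> S // Lstar S m. \<exists>e\<in>C. m e e = e)"

definition contraction_on :: "nat set \<Rightarrow> (nat \<Rightarrow> nat) \<Rightarrow> bool" where
  "contraction_on A f \<longleftrightarrow>
     (\<forall>x\<in>A. \<forall>y\<in>A. \<bar>int (f x) - int (f y)\<bar> \<le> \<bar>int x - int y\<bar>)"

definition order_decreasing_on :: "nat set \<Rightarrow> (nat \<Rightarrow> nat) \<Rightarrow> bool" where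
  "order_decreasing_on A f \<longleftrightarrow> (\<forall>x\<in>A. f x \<le> x)"

text \<open>Maps from \<open>{1..n}\<close> to itself are extensional functions (\<^const>\<open>undefined\<close> outside
  \<open>{1..n}\<close>), so that equality of functions is equality of maps.\<close>

definition ODCT :: "nat \<Rightarrow> (nat \<Rightarrow> nat) set" where
  "ODCT n = {f \<in> {1..n} \<rightarrow>\<^sub>E {1..n}.
     contraction_on {1..n} f \<and> mono_on {1..n} f \<and> order_decreasing_on {1..n} f}"

text \<open>Maps act on the right, so the product \<open>f g\<close> applies \<open>f\<close> first.\<close>

definition ODCT_mult :: "nat \<Rightarrow> (nat \<Rightarrow> nat) \<Rightarrow> (nat \<Rightarrow> nat) \<Rightarrow> (nat \<Rightarrow> nat)" where
  "ODCT_mult n f g = compose {1..n} g f"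

lemma semigroup_on_ODCT: "semigroup_on (ODCT n) (ODCT_mult n)"
proof -
  have closed: "compose {1..n} g f \<in> ODCT n" if f: "f \<in> ODCT n" and g: "g \<in> ODCT n" for f g
  proof -
    have mem: "f x \<in> {1..n}" "g x \<in> {1..n}" if "x \<in> {1..n}" for x
      using f g that unfolding ODCT_def by (blast dest: PiE_mem)+
    have "contraction_on {1..n} (compose {1..n} g f)"
      unfolding contraction_on_def
    proof (intro ballI)
      fix x y assume xy: "x \<in> {1..n}" "y \<in> {1..n}"
      have "\<bar>int (g (f x)) - int (g (f y))\<bar> \<le> \<bar>int (f x) - int (f y)\<bar>"
        using g mem xy unfolding ODCT_def contraction_on_def by blast
      also have "\<dots> \<le> \<bar>int x - int y\<bar>"
        using f xy unfolding ODCT_def contraction_on_def by blast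
      finally show "\<bar>int (compose {1..n} g f x) - int (compose {1..n} g f y)\<bar> \<le> \<bar>int x - int y\<bar>"
        using xy by (simp add: compose_eq)
    qed
    moreover have "mono_on {1..n} (compose {1..n} g f)"
    proof (rule mono_onI)
      fix x y assume xy: "x \<in> {1..n}" "y \<in> {1..n}" "x \<le> y"
      have "f x \<le> f y"
        using f xy unfolding ODCT_def by (blast dest: mono_onD)
      then have "g (f x) \<le> g (f y)"
        using g mem xy unfolding ODCT_def by (blast dest: mono_onD)
      then show "compose {1..n} g f x \<le> compose {1..n} g f y"
        using xy by (simp add: compose_eq)
    qed
    moreover have "order_decreasing_on {1..n} (compose {1..n} g f)"
      unfolding order_decreasing_on_def
    proof
      fix x assume x: "x \<in> {1..n}"
      have "g (f x) \<le> f x"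
        using g mem x unfolding ODCT_def order_decreasing_on_def by blast
      also have "f x \<le> x"
        using f x unfolding ODCT_def order_decreasing_on_def by blast
      finally show "compose {1..n} g f x \<le> x"
        using x by (simp add: compose_eq)
    qed
    moreover have "compose {1..n} g f \<in> {1..n} \<rightarrow>\<^sub>E {1..n}"
    proof (rule PiE_I)
      show "compose {1..n} g f x \<in> {1..n}" if "x \<in> {1..n}" for x
        using mem mem(1)[OF that] that by (metis compose_eq)
      show "compose {1..n} g f x = undefined" if "x \<notin> {1..n}" for x
        using that by (auto simp: compose_def)
    qed
    ultimately show ?thesis by (simp add: ODCT_def)
  qed
  have assoc: "compose {1..n} h (compose {1..n} g f) = compose {1..n} (compose {1..n} h g) f"
    if "f \<in> ODCT n" for f g h
  proof -
    have "f \<in> {1..n} \<rightarrow> {1..n}" using that by (auto simp: ODCT_def)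
    then show ?thesis by (rule compose_assoc)
  qed
  show ?thesis
    unfolding semigroup_on_def ODCT_mult_def using closed assoc by blast
qed

end

theory Submission
  imports Defs
begin

text \<open>
  Whether two right multipliers \<open>\<mu>\<close>, \<open>\<lambda>\<close> have the same effect on \<open>f\<close> depends only on the image of
  \<open>f\<close>: since \<open>f\<close> acts first, \<open>f\<mu> = f\<lambda>\<close> says that \<open>\<mu>\<close> and \<open>\<lambda>\<close> agree on this image. Hence elements
  with the same image are \<open>L\<^sup>*\<close>-related, and it suffices to find an idempotent with the same image
  as a given \<open>f\<close>.

  The image of \<open>f\<close> is always an initial segment. Being order-decreasing, \<open>f\<close> fixes \<open>1\<close>; being a
  contraction, it never jumps by more than one, so by the discrete intermediate value theorem it
  takes all values between \<open>f 1 = 1\<close> and its largest value \<open>f n\<close>. The truncation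
  \<open>x \<mapsto> min x (f n)\<close> is an order-preserving, order-decreasing contraction that is the identity on its
  image \<open>{1..f n}\<close>, so it is the required idempotent.
\<close>

text \<open>
  Reading an adjoined identity as the identity map, every multiplier acts on the points of the image
  of \<open>f\<close>, and the product with \<open>f\<close> records nothing but this action.
\<close>

lemma mult1_ODCT_eq_iff:
  assumes "f \<in> ODCT n"
  shows "mult1 (ODCT_mult n) f u = mult1 (ODCT_mult n) f v \<longleftrightarrow>
    (\<forall>y\<in>f ` {1..n}. case_option y (\<lambda>g. g y) u = case_option y (\<lambda>g. g y) v)"
proof -
  have "f \<in> extensional {1..n}"
    using assms by (auto simp: ODCT_def PiE_def)
  then have act: "mult1 (ODCT_mult n) f w = (\<lambda>x\<in>{1..n}. case_option (f x) (\<lambda>g. g (f x)) w)" for w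
    by (cases w) (auto simp: mult1_def ODCT_mult_def compose_def extensional_restrict)
  show ?thesis
    unfolding act by (auto simp: restrict_def fun_eq_iff)
qed

lemma Lstar_if_same_image:
  assumes "f \<in> ODCT n" "g \<in> ODCT n" "f ` {1..n} = g ` {1..n}"
  shows "(f, g) \<in> Lstar (ODCT n) (ODCT_mult n)"
  using assms by (simp add: Lstar_def mult1_ODCT_eq_iff)

text \<open>
  All values up to \<open>f n\<close> are attained because \<open>f\<close> starts at \<open>1\<close> and, as a contraction, moves in steps
  of at most one.
\<close>

lemma ODCT_image:
  assumes n: "n \<ge> 1" and f: "f \<in> ODCT n"
  shows "f ` {1..n} = {1..f n}"
proof
  have maps: "f x \<in> {1..n}" if "x \<in> {1..n}" for x
    using f that unfolding ODCT_def by (blast dest: PiE_mem)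
  have mono: "f x \<le> f n" if "x \<in> {1..n}" for x
    using f n that mono_onD[of "{1..n}" f x n] by (simp add: ODCT_def)
  show "f ` {1..n} \<subseteq> {1..f n}"
    using maps mono by fastforce
  have "f 1 \<le> 1"
    using f n by (auto simp: ODCT_def order_decreasing_on_def)
  moreover have "\<bar>int (f (Suc i)) - int (f i)\<bar> \<le> 1" if "1 \<le> i \<and> i < n" for i
  proof -
    have "Suc i \<in> {1..n}" "i \<in> {1..n}"
      using that by auto
    then have "\<bar>int (f (Suc i)) - int (f i)\<bar> \<le> \<bar>int (Suc i) - int i\<bar>"
      using f unfolding ODCT_def contraction_on_def by blast
    then show ?thesis by simp
  qed
  ultimately have "\<exists>i. 1 \<le> i \<and> i \<le> n \<and> int (f i) = int k" if "k \<in> {1..f n}" for k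
    using n that by (intro nat_intermed_int_val) auto
  then show "{1..f n} \<subseteq> f ` {1..n}"
    by (metis atLeastAtMost_iff image_eqI of_nat_eq_iff subsetI)
qed

lemma truncation_in_ODCT:
  assumes "m \<ge> 1"
  shows "(\<lambda>x\<in>{1..n}. min x m) \<in> ODCT n"
  using assms
  by (auto simp: ODCT_def contraction_on_def order_decreasing_on_def mono_on_def)

lemma truncation_idempotent:
  assumes "m \<ge> 1"
  shows "ODCT_mult n (\<lambda>x\<in>{1..n}. min x m) (\<lambda>x\<in>{1..n}. min x m) = (\<lambda>x\<in>{1..n}. min x m)"
  using assms by (auto simp: ODCT_mult_def compose_def fun_eq_iff)

theorem lemma10:
  fixes n :: nat
  assumes "n \<ge> 1"
  shows "left_abundant (ODCT n) (ODCT_mult n)"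
  unfolding left_abundant_def
proof
  fix C assume "C \<in> ODCT n // Lstar (ODCT n) (ODCT_mult n)"
  then obtain f where f: "f \<in> ODCT n" and C: "C = Lstar (ODCT n) (ODCT_mult n) `` {f}"
    by (rule quotientE)
  define e where "e = (\<lambda>x\<in>{1..n}. min x (f n))"
  have fn: "1 \<le> f n" "f n \<le> n"
    using f assms by (auto simp: ODCT_def order_decreasing_on_def dest: PiE_mem[of _ _ _ n])
  have e: "e \<in> ODCT n" "ODCT_mult n e e = e"
    unfolding e_def using fn by (simp_all only: truncation_in_ODCT truncation_idempotent)
  have "e n = f n"
    using assms fn by (simp add: e_def)
  then have "f ` {1..n} = e ` {1..n}"
    using ODCT_image[OF assms] f e by simp
  then have "e \<in> C"
    unfolding C using Lstar_if_same_image f e by blast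
  then show "\<exists>e\<in>C. ODCT_mult n e e = e"
    using e by blast
qed

end
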